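(* The Ehrhart polynomials $L_{\nabla}(n)$ of the $3$- and $4$-dimensional prime compressed flow polytopes are the following: $\nabla_{\mathrm{I.a}}^{(3)}$: $\binom{n+3}{3}=\frac16(n^3+6n^2+11n+6)$; $\nabla_{\mathrm{II.c}}^{(3)}$: $\binom{n+3}{3}+\binom{n+2}{3}=\frac16(2n^3+9n^2+13n+6)$; $\nabla_{\mathrm{I.b}}^{(3)}$: $\binom{n+3}{3}+2\binom{n+2}{3}+\binom{n+1}{3}=\frac16(4n^3+12n^2+14n+6)$; $\nabla_{\mathrm{II.c}}^{(4)}$: $\binom{n+4}{4}=\frac1{24}(n^4+10n^3+35n^2+50n+24)$; $\nabla_{\mathrm{I.d}}^{(4)}$: $\binom{n+4}{4}+\binom{n+3}{4}=\frac1{24}(2n^4+16n^3+46n^2+56n+24)$; $\nabla_{\mathrm{II.f}}^{(4)}$: $\binom{n+4}{4}+2\binom{n+3}{4}=\frac1{24}(3n^4+22n^3+57n^2+62n+24)$; $\nabla_{\mathrm{III.d}}^{(4)}$: $\binom{n+4}{4}+3\binom{n+3}{4}+\binom{n+2}{4}=\frac1{24}(5n^4+30n^3+67n^2+66n+24)$; $\nabla_{\mathrm{I.a}}^{(4)}$: $\binom{n+4}{4}+4\binom{n+3}{4}+\binom{n+2}{4}=\frac1{24}(6n^4+36n^3+78n^2+72n+24)$; $\nabla_{\mathrm{V.b}}^{(4)}$: $\binom{n+4}{4}+\binom{n+3}{4}+\binom{n+2}{4}=\frac1{24}(3n^4+18n^3+45n^2+54n+24)$; $\nabla_{\mathrm{VI.c}}^{(4)}$: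 $\binom{n+4}{4}+2\binom{n+3}{4}+\binom{n+2}{4}=\frac1{24}(4n^4+24n^3+56n^2+60n+24)$; $\nabla_{\mathrm{VII.b}}^{(4)}$: $\binom{n+4}{4}+3\binom{n+3}{4}+2\binom{n+2}{4}=\frac1{24}(6n^4+32n^3+66n^2+64n+24)$; $\nabla_{\mathrm{VIII.a}}^{(4)}$: $\binom{n+4}{4}+5\binom{n+3}{4}+5\binom{n+2}{4}+\binom{n+1}{4}=\frac1{24}(12n^4+48n^3+84n^2+72n+24)$; $\nabla_{\mathrm{IX.a}}^{(4)}$: $\binom{n+4}{4}+5\binom{n+3}{4}+5\binom{n+2}{4}=\frac1{24}(11n^4+50n^3+85n^2+70n+24)$; $\nabla_{\mathrm{X.a}}^{(4)}$: $\binom{n+4}{4}+4\binom{n+3}{4}+3\binom{n+2}{4}=\frac1{24}(8n^4+40n^3+76n^2+68n+24)$.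
   Context: The Ehrhart polynomial of a lattice polytope $\nabla\subset\mathbb{R}^d$ is the polynomial $L_{\nabla}$ with rational coefficients such that for every positive integer $n$, $L_{\nabla}(n)$ is the number of points of $\mathbb{Z}^d$ in $n\nabla$. The $3$- and $4$-dimensional prime compressed flow polytopes are, up to equivalence (affine isomorphism of affine spans preserving the lattices of integer points), exactly the following polytopes. In $\mathbb{R}^3$ (coordinates $x,y,z$): - $\nabla_{\mathrm{I.a}}^{(3)}$: $x,y,z\ge0$, $x+y+z\le1$. - $\nabla_{\mathrm{II.c}}^{(3)}$: $x,y,z\ge0$, $y+z\le1$, $x+y\le1$. - $\nabla_{\mathrm{I.b}}^{(3)}$: $0\le x,y,z\le1$, $0\le x+y-z\le1$. In $\mathbb{R}^4$ (coordinates $x,y,z,w$): - $\nabla_{\mathrm{II.c}}^{(4)}$: $x,y,z,w\ge0$, $x+y+z+w\le1$. - $\nabla_{\mathrm{I.d}}^{(4)}$: $x,y,z,w\ge0$, $z\le x+y$, $x+y+w\le1$. - $\nabla_{\mathrm{II.f}}^{(4)}$: $x,y,z,w\ge0$, $w\le x+y+z\le1$. - $\nabla_{\mathrm{III.d}}^{(4)}$: $x,y,z,w\ge0$, $z\le x+y\le1$, $x+y+w\le1+z$. - $\nabla_{\mathrm{I.a}}^{(4)}$: $x,y,z,w\ge0$, $x+y\le1$, $z\le x+y$, $w\le x+y$. - $\nabla_{\mathrm{V.b}}^{(4)}$: $x,y,z,w\ge0$, $x\le z+w\le1$, $z\le x+y\le1$, $y+w\le1$. - $\nabla_{\mathrm{VI.c}}^{(4)}$: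 $x,y,z,w\ge0$, $x\le z+w\le1$, $w\le x+y\le1$. - $\nabla_{\mathrm{VII.b}}^{(4)}$: $0\le x\le1$, $0\le y\le1$, $z,w\ge0$, $z+w\le1$, $z+w\le x+y\le1+z$. - $\nabla_{\mathrm{VIII.a}}^{(4)}$: $0\le x,y,z,w\le1$, $y\le z+w\le1+y$, $x\le z+w\le1+x$. - $\nabla_{\mathrm{IX.a}}^{(4)}$: $0\le x,y,z,w\le1$, $x+y\le z+w\le1+x+y$. - $\nabla_{\mathrm{X.a}}^{(4)}$: $0\le x,y,z\le1$, $w\ge0$, $x\le y+z$, $y+z+w\le1+x$. *)

theory Defs
  imports "HOL-Analysis.Analysis" "HOL-Computational_Algebra.Polynomial"
begin

definition dilate :: "nat \<Rightarrow> (real ^ 'd) set \<Rightarrow> (real ^ 'd) set" where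
  "dilate n P = (\<lambda>v. real n *\<^sub>R v) ` P"

definition integer_points :: "(real ^ 'd) set \<Rightarrow> (real ^ 'd) set" where
  "integer_points S = {v \<in> S. \<forall>i. v $ i \<in> \<int>}"

text \<open>Only positive dilation factors are constrained, as usual. For an arbitrary set such a
  polynomial need not exist; it is unique whenever it does.\<close>

definition is_ehrhart_polynomial :: "(real ^ 'd) set \<Rightarrow> rat poly \<Rightarrow> bool" where
  "is_ehrhart_polynomial P L \<longleftrightarrow>
     (\<forall>n::nat. n > 0 \<longrightarrow>
        finite (integer_points (dilate n P)) \<and>
        poly L (of_nat n) = of_nat (card (integer_points (dilate n P))))"

lemma is_ehrhart_polynomial_unique:
  assumes "is_ehrhart_polynomial P L" "is_ehrhart_polynomial P M"
  shows "L = M"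
proof (rule ccontr)
  assume "L \<noteq> M"
  then have "finite {x. poly (L - M) x = 0}"
    by (intro poly_roots_finite) simp
  moreover have "of_nat ` {0<..} \<subseteq> {x. poly (L - M) x = 0}"
    using assms by (auto simp: is_ehrhart_polynomial_def)
  ultimately have "finite ((of_nat :: nat \<Rightarrow> rat) ` {0<..})"
    by (rule finite_subset[rotated])
  then have "finite {0::nat<..}"
    by (rule finite_imageD) (simp add: inj_on_def)
  then show False
    by (simp add: infinite_Ioi)
qed

subsection \<open>The three-dimensional polytopes\<close>

definition nabla3_Ia :: "(real ^ 3) set" where
  "nabla3_Ia = {vector [x, y, z] | x y z.
     x \<ge> 0 \<and> y \<ge> 0 \<and> z \<ge> 0 \<and> x + y + z \<le> 1}"

definition nabla3_IIc :: "(real ^ 3) set" where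
  "nabla3_IIc = {vector [x, y, z] | x y z.
     x \<ge> 0 \<and> y \<ge> 0 \<and> z \<ge> 0 \<and> y + z \<le> 1 \<and> x + y \<le> 1}"

definition nabla3_Ib :: "(real ^ 3) set" where
  "nabla3_Ib = {vector [x, y, z] | x y z.
     0 \<le> x \<and> x \<le> 1 \<and> 0 \<le> y \<and> y \<le> 1 \<and> 0 \<le> z \<and> z \<le> 1 \<and>
     0 \<le> x + y - z \<and> x + y - z \<le> 1}"

subsection \<open>The four-dimensional polytopes\<close>

definition nabla4_IIc :: "(real ^ 4) set" where
  "nabla4_IIc = {vector [x, y, z, w] | x y z w.
     x \<ge> 0 \<and> y \<ge> 0 \<and> z \<ge> 0 \<and> w \<ge> 0 \<and> x + y + z + w \<le> 1}"

definition nabla4_Id :: "(real ^ 4) set" where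
  "nabla4_Id = {vector [x, y, z, w] | x y z w.
     x \<ge> 0 \<and> y \<ge> 0 \<and> z \<ge> 0 \<and> w \<ge> 0 \<and> z \<le> x + y \<and> x + y + w \<le> 1}"

definition nabla4_IIf :: "(real ^ 4) set" where
  "nabla4_IIf = {vector [x, y, z, w] | x y z w.
     x \<ge> 0 \<and> y \<ge> 0 \<and> z \<ge> 0 \<and> w \<ge> 0 \<and> w \<le> x + y + z \<and> x + y + z \<le> 1}"

definition nabla4_IIId :: "(real ^ 4) set" where
  "nabla4_IIId = {vector [x, y, z, w] | x y z w.
     x \<ge> 0 \<and> y \<ge> 0 \<and> z \<ge> 0 \<and> w \<ge> 0 \<and>
     z \<le> x + y \<and> x + y \<le> 1 \<and> x + y + w \<le> 1 + z}"

definition nabla4_Ia :: "(real ^ 4) set" where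
  "nabla4_Ia = {vector [x, y, z, w] | x y z w.
     x \<ge> 0 \<and> y \<ge> 0 \<and> z \<ge> 0 \<and> w \<ge> 0 \<and> x + y \<le> 1 \<and> z \<le> x + y \<and> w \<le> x + y}"

definition nabla4_Vb :: "(real ^ 4) set" where
  "nabla4_Vb = {vector [x, y, z, w] | x y z w.
     x \<ge> 0 \<and> y \<ge> 0 \<and> z \<ge> 0 \<and> w \<ge> 0 \<and>
     x \<le> z + w \<and> z + w \<le> 1 \<and> z \<le> x + y \<and> x + y \<le> 1 \<and> y + w \<le> 1}"

definition nabla4_VIc :: "(real ^ 4) set" where
  "nabla4_VIc = {vector [x, y, z, w] | x y z w.
     x \<ge> 0 \<and> y \<ge> 0 \<and> z \<ge> 0 \<and> w \<ge> 0 \<and>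
     x \<le> z + w \<and> z + w \<le> 1 \<and> w \<le> x + y \<and> x + y \<le> 1}"

definition nabla4_VIIb :: "(real ^ 4) set" where
  "nabla4_VIIb = {vector [x, y, z, w] | x y z w.
     0 \<le> x \<and> x \<le> 1 \<and> 0 \<le> y \<and> y \<le> 1 \<and> z \<ge> 0 \<and> w \<ge> 0 \<and>
     z + w \<le> 1 \<and> z + w \<le> x + y \<and> x + y \<le> 1 + z}"

definition nabla4_VIIIa :: "(real ^ 4) set" where
  "nabla4_VIIIa = {vector [x, y, z, w] | x y z w.
     0 \<le> x \<and> x \<le> 1 \<and> 0 \<le> y \<and> y \<le> 1 \<and> 0 \<le> z \<and> z \<le> 1 \<and> 0 \<le> w \<and> w \<le> 1 \<and>
     y \<le> z + w \<and> z + w \<le> 1 + y \<and> x \<le> z + w \<and> z + w \<le> 1 + x}"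

definition nabla4_IXa :: "(real ^ 4) set" where
  "nabla4_IXa = {vector [x, y, z, w] | x y z w.
     0 \<le> x \<and> x \<le> 1 \<and> 0 \<le> y \<and> y \<le> 1 \<and> 0 \<le> z \<and> z \<le> 1 \<and> 0 \<le> w \<and> w \<le> 1 \<and>
     x + y \<le> z + w \<and> z + w \<le> 1 + x + y}"

definition nabla4_Xa :: "(real ^ 4) set" where
  "nabla4_Xa = {vector [x, y, z, w] | x y z w.
     0 \<le> x \<and> x \<le> 1 \<and> 0 \<le> y \<and> y \<le> 1 \<and> 0 \<le> z \<and> z \<le> 1 \<and> w \<ge> 0 \<and>
     x \<le> y + z \<and> y + z + w \<le> 1 + x}"

end

theory Submission
  imports Defs
begin

text \<open>
  Every polytope in the list lies in the nonnegative orthant, so the integer points of its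
  $n$-th dilate are tuples of natural numbers satisfying homogeneous linear inequalities in
  the coordinates and $n$. The Ehrhart polynomials are obtained by counting these tuples; the
  coefficients of the binomials in each formula form the $h^*$-vector, and this is the form in
  which the counts are carried along. Three mechanisms produce all of them.

  Slicing: the simplices and \<open>nabla3_IIc\<close>, \<open>nabla4_Id\<close>, \<open>nabla4_IIf\<close> and \<open>nabla4_Ia\<close> are
  pyramids. The lattice points of the $n$-th dilate lie on slices indexed by $s \<le> n$, where
  the slice at height $s$ is the $s$-th dilate of a smaller polytope, or a product of dilated
  segments and triangles. If each slice is counted by $\sum_k h_k \binom{s+k}{m}$, with all
  $k \<le> m$, the whole is counted by $\sum_k h_k \binom{n+k+1}{m+1}$, by the hockey-stick identity
  \<open>sum_choose_pyramid\<close>. Counts of slices that are products are rewritten as such sums of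
  binomials by \<open>choose_mult_identities\<close>.

  Cutting: the polytopes \<open>nabla3_Ib\<close>, \<open>nabla4_VIc\<close>, \<open>nabla4_VIIb\<close>, \<open>nabla4_VIIIa\<close>,
  \<open>nabla4_IXa\<close> and \<open>nabla4_Xa\<close> are cut along lattice hyperplanes so that each piece is
  unimodularly equivalent to a polytope counted before. In each cut one of the two pieces is a pyramid
  whose base lies in the cutting hyperplane and whose apex has lattice distance one from it. The points
  on the cut are assigned to the other piece. Removing the base of the pyramid from its $n$-th dilate
  leaves a copy of the $(n-1)$-st dilate, so its $h^*$-vector enters shifted by one
  place; for example $(1,4,1)$ and $(0,1,4,1)$ add up to the vector $(1,5,5,1)$ of
  \<open>nabla4_VIIIa\<close>. The polytope \<open>nabla4_IIId\<close> is also cut, into \<open>nabla4_Id\<close> and a half-open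
  rest that is sliced directly.

  Half-open triangulation: the six vertices of \<open>nabla4_Vb\<close> satisfy a single affine relation
  $A + B + O = P + Q + R$. It yields a partition into three unimodular simplices with zero, one and two
  facets removed, which is the $h^*$-vector $(1,1,1)$.
\<close>

section \<open>Lattice points as tuples of natural numbers\<close>

text \<open>Nonnegativity turns integral coordinates into natural numbers, so that a set of natural
  points can be counted in place of the integer points of the dilate.\<close>

lemma is_ehrhart_polynomialI:
  fixes P :: "(real ^ 'd) set"
  assumes nonneg: "\<And>v i. v \<in> P \<Longrightarrow> 0 \<le> v $ i"
    and bij: "\<And>n. 0 < n \<Longrightarrow>
      bij_betw (e n) (S n) {v. (\<forall>i. v $ i \<in> \<nat>) \<and> (1 / real n) *\<^sub>R v \<in> P}"
    and finite: "\<And>n. finite (S n)"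
    and card: "\<And>n. 0 < n \<Longrightarrow> of_nat (card (S n)) = poly L (of_nat n)"
  shows "is_ehrhart_polynomial P L"
proof -
  have "finite (integer_points (dilate n P)) \<and> card (integer_points (dilate n P)) = card (S n)"
    if n: "0 < n" for n
  proof -
    have "integer_points (dilate n P) = {v. (\<forall>i. v $ i \<in> \<nat>) \<and> (1 / real n) *\<^sub>R v \<in> P}"
    proof (intro equalityI subsetI)
      fix v assume "v \<in> integer_points (dilate n P)"
      then obtain u where u: "u \<in> P" "v = real n *\<^sub>R u" and int: "\<forall>i. v $ i \<in> \<int>"
        by (auto simp: integer_points_def dilate_def)
      with nonneg[OF u(1)] n show "v \<in> {v. (\<forall>i. v $ i \<in> \<nat>) \<and> (1 / real n) *\<^sub>R v \<in> P}"
        by (auto simp: Nats_altdef2)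
    next
      fix v assume v: "v \<in> {v. (\<forall>i. v $ i \<in> \<nat>) \<and> (1 / real n) *\<^sub>R v \<in> P}"
      then have "v = real n *\<^sub>R ((1 / real n) *\<^sub>R v)" using n by simp
      with v have "v \<in> dilate n P" unfolding dilate_def by blast
      with v Nats_subset_Ints show "v \<in> integer_points (dilate n P)"
        by (auto simp: integer_points_def)
    qed
    with bij[OF n] finite show ?thesis
      by (metis bij_betw_finite bij_betw_same_card)
  qed
  with card show ?thesis
    by (simp add: is_ehrhart_polynomial_def)
qed

text \<open>The versions for tuples ask for the constraints in homogenized form: the predicate at
  the point divided by \<open>n\<close> has to become membership in \<open>S n\<close>.\<close>

lemma is_ehrhart_polynomial_3I:
  fixes S :: "nat \<Rightarrow> (nat \<times> nat \<times> nat) set"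
  assumes P: "P = {vector [x, y, z] | x y z. Q x y z}"
    and nonneg: "\<And>x y z. Q x y z \<Longrightarrow> 0 \<le> x \<and> 0 \<le> y \<and> 0 \<le> z"
    and scale: "\<And>n x y z. 0 < n \<Longrightarrow>
      Q (real x / real n) (real y / real n) (real z / real n) \<longleftrightarrow> (x, y, z) \<in> S n"
    and finite: "\<And>n. finite (S n)"
    and card: "\<And>n. 0 < n \<Longrightarrow> of_nat (card (S n)) = poly L (of_nat n)"
  shows "is_ehrhart_polynomial (P :: (real ^ 3) set) L"
proof (rule is_ehrhart_polynomialI[where S = S])
  show "0 \<le> v $ i" if "v \<in> P" for v i
  proof -
    from that obtain x y z where "Q x y z" and "v = vector [x, y, z]"
      unfolding P by blast
    with nonneg show ?thesis using exhaust_3[of i] by auto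
  qed
next
  fix n :: nat assume n: "0 < n"
  have mem: "u \<in> P \<longleftrightarrow> Q (u $ 1) (u $ 2) (u $ 3)" for u
  proof
    assume "Q (u $ 1) (u $ 2) (u $ 3)"
    moreover have "u = vector [u $ 1, u $ 2, u $ 3]" by (simp add: vec_eq_iff forall_3)
    ultimately show "u \<in> P" unfolding P by blast
  qed (auto simp: P)
  show "bij_betw (\<lambda>(x, y, z). vector [real x, real y, real z]) (S n)
      {v. (\<forall>i. v $ i \<in> \<nat>) \<and> (1 / real n) *\<^sub>R v \<in> P}"
    by (rule bij_betw_byWitness[where f' = "\<lambda>v. (nat \<lfloor>v $ 1\<rfloor>, nat \<lfloor>v $ 2\<rfloor>, nat \<lfloor>v $ 3\<rfloor>)"])
      (auto simp: mem forall_3 vec_eq_iff scale[OF n] elim!: Nats_cases)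
qed (use finite card in auto)

lemma vector_4:
  "(vector [x, y, z, w] :: 'a::zero ^ 4) $ 1 = x"
  "(vector [x, y, z, w] :: 'a ^ 4) $ 2 = y"
  "(vector [x, y, z, w] :: 'a ^ 4) $ 3 = z"
  "(vector [x, y, z, w] :: 'a ^ 4) $ 4 = w"
  unfolding vector_def by simp_all

lemma is_ehrhart_polynomial_4I:
  fixes S :: "nat \<Rightarrow> (nat \<times> nat \<times> nat \<times> nat) set"
  assumes P: "P = {vector [x, y, z, w] | x y z w. Q x y z w}"
    and nonneg: "\<And>x y z w. Q x y z w \<Longrightarrow> 0 \<le> x \<and> 0 \<le> y \<and> 0 \<le> z \<and> 0 \<le> w"
    and scale: "\<And>n x y z w. 0 < n \<Longrightarrow>
      Q (real x / real n) (real y / real n) (real z / real n) (real w / real n) \<longleftrightarrow>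
        (x, y, z, w) \<in> S n"
    and finite: "\<And>n. finite (S n)"
    and card: "\<And>n. 0 < n \<Longrightarrow> of_nat (card (S n)) = poly L (of_nat n)"
  shows "is_ehrhart_polynomial (P :: (real ^ 4) set) L"
proof (rule is_ehrhart_polynomialI[where S = S])
  show "0 \<le> v $ i" if "v \<in> P" for v i
  proof -
    from that obtain x y z w where "Q x y z w" and "v = vector [x, y, z, w]"
      unfolding P by blast
    with nonneg show ?thesis using exhaust_4[of i] by (auto simp: vector_4)
  qed
next
  fix n :: nat assume n: "0 < n"
  have mem: "u \<in> P \<longleftrightarrow> Q (u $ 1) (u $ 2) (u $ 3) (u $ 4)" for u
  proof
    assume "Q (u $ 1) (u $ 2) (u $ 3) (u $ 4)"
    moreover have "u = vector [u $ 1, u $ 2, u $ 3, u $ 4]" by (simp add: vec_eq_iff forall_4 vector_4)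
    ultimately show "u \<in> P" unfolding P by blast
  qed (auto simp: P vector_4)
  show "bij_betw (\<lambda>(x, y, z, w). vector [real x, real y, real z, real w]) (S n)
      {v. (\<forall>i. v $ i \<in> \<nat>) \<and> (1 / real n) *\<^sub>R v \<in> P}"
    by (rule bij_betw_byWitness
          [where f' = "\<lambda>v. (nat \<lfloor>v $ 1\<rfloor>, nat \<lfloor>v $ 2\<rfloor>, nat \<lfloor>v $ 3\<rfloor>, nat \<lfloor>v $ 4\<rfloor>)"])
      (auto simp: mem forall_4 vec_eq_iff vector_4 scale[OF n] elim!: Nats_cases)
qed (use finite card in auto)

definition pts3_Ia :: "nat \<Rightarrow> (nat \<times> nat \<times> nat) set" where
  "pts3_Ia n = {(x, y, z). x + y + z \<le> n}"

definition pts3_IIc :: "nat \<Rightarrow> (nat \<times> nat \<times> nat) set" where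
  "pts3_IIc n = {(x, y, z). y + z \<le> n \<and> x + y \<le> n}"

definition pts3_Ib :: "nat \<Rightarrow> (nat \<times> nat \<times> nat) set" where
  "pts3_Ib n = {(x, y, z). x \<le> n \<and> y \<le> n \<and> z \<le> n \<and> z \<le> x + y \<and> x + y \<le> n + z}"

definition pts4_IIc :: "nat \<Rightarrow> (nat \<times> nat \<times> nat \<times> nat) set" where
  "pts4_IIc n = {(x, y, z, w). x + y + z + w \<le> n}"

definition pts4_Id :: "nat \<Rightarrow> (nat \<times> nat \<times> nat \<times> nat) set" where
  "pts4_Id n = {(x, y, z, w). z \<le> x + y \<and> x + y + w \<le> n}"

definition pts4_IIf :: "nat \<Rightarrow> (nat \<times> nat \<times> nat \<times> nat) set" where
  "pts4_IIf n = {(x, y, z, w). w \<le> x + y + z \<and> x + y + z \<le> n}"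

definition pts4_IIId :: "nat \<Rightarrow> (nat \<times> nat \<times> nat \<times> nat) set" where
  "pts4_IIId n = {(x, y, z, w). z \<le> x + y \<and> x + y \<le> n \<and> x + y + w \<le> n + z}"

definition pts4_Ia :: "nat \<Rightarrow> (nat \<times> nat \<times> nat \<times> nat) set" where
  "pts4_Ia n = {(x, y, z, w). x + y \<le> n \<and> z \<le> x + y \<and> w \<le> x + y}"

definition pts4_Vb :: "nat \<Rightarrow> (nat \<times> nat \<times> nat \<times> nat) set" where
  "pts4_Vb n = {(x, y, z, w).
     x \<le> z + w \<and> z + w \<le> n \<and> z \<le> x + y \<and> x + y \<le> n \<and> y + w \<le> n}"

definition pts4_VIc :: "nat \<Rightarrow> (nat \<times> nat \<times> nat \<times> nat) set" where
  "pts4_VIc n = {(x, y, z, w). x \<le> z + w \<and> z + w \<le> n \<and> w \<le> x + y \<and> x + y \<le> n}"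

definition pts4_VIIb :: "nat \<Rightarrow> (nat \<times> nat \<times> nat \<times> nat) set" where
  "pts4_VIIb n = {(x, y, z, w).
     x \<le> n \<and> y \<le> n \<and> z + w \<le> n \<and> z + w \<le> x + y \<and> x + y \<le> n + z}"

definition pts4_VIIIa :: "nat \<Rightarrow> (nat \<times> nat \<times> nat \<times> nat) set" where
  "pts4_VIIIa n = {(x, y, z, w). x \<le> n \<and> y \<le> n \<and> z \<le> n \<and> w \<le> n \<and>
     y \<le> z + w \<and> z + w \<le> n + y \<and> x \<le> z + w \<and> z + w \<le> n + x}"

definition pts4_IXa :: "nat \<Rightarrow> (nat \<times> nat \<times> nat \<times> nat) set" where
  "pts4_IXa n = {(x, y, z, w). x \<le> n \<and> y \<le> n \<and> z \<le> n \<and> w \<le> n \<and>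
     x + y \<le> z + w \<and> z + w \<le> n + x + y}"

definition pts4_Xa :: "nat \<Rightarrow> (nat \<times> nat \<times> nat \<times> nat) set" where
  "pts4_Xa n = {(x, y, z, w).
     x \<le> n \<and> y \<le> n \<and> z \<le> n \<and> x \<le> y + z \<and> y + z + w \<le> n + x}"

lemmas pts_defs = pts3_Ia_def pts3_IIc_def pts3_Ib_def pts4_IIc_def pts4_Id_def pts4_IIf_def
  pts4_IIId_def pts4_Ia_def pts4_Vb_def pts4_VIc_def pts4_VIIb_def pts4_VIIIa_def pts4_IXa_def
  pts4_Xa_def

lemma finite_pts3:
  "finite (pts3_Ia n)" "finite (pts3_IIc n)" "finite (pts3_Ib n)"
  by (rule finite_subset[of _ "{..n} \<times> {..n} \<times> {..n}"]; auto simp: pts_defs)+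

lemma finite_pts4:
  "finite (pts4_IIc n)" "finite (pts4_Id n)" "finite (pts4_IIf n)" "finite (pts4_IIId n)"
  "finite (pts4_Ia n)" "finite (pts4_Vb n)" "finite (pts4_VIc n)" "finite (pts4_VIIb n)"
  "finite (pts4_VIIIa n)" "finite (pts4_IXa n)" "finite (pts4_Xa n)"
  by (rule finite_subset[of _ "{..n} \<times> {..n} \<times> {..n} \<times> {..n}"]; auto simp: pts_defs)+

section \<open>Binomial identities for slices\<close>

text \<open>This hockey-stick identity computes the Ehrhart function of a pyramid from that of its
  base. The condition makes the missing initial part of the column of Pascal's triangle vanish.\<close>

lemma sum_choose_pyramid:
  assumes "k \<le> m"
  shows "(\<Sum>s\<le>n. s + k choose m) = (n + Suc k choose Suc m)"
  using assms by (induction n) (simp_all add: le_imp_less_Suc)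

text \<open>The products are the Ehrhart functions of the unit square, of segment times triangle,
  of segment times triangle without one edge, and of the unit cube. The sums on the right exhibit
  their $h^*$-vectors. The cube is a segment times the square, and the square is a closed and
  a half-open triangle; hence the last identity follows from the other three.\<close>

lemma choose_mult_identities:
  fixes s :: nat
  shows "(s + 1)\<^sup>2 = (s + 2 choose 2) + (s + 1 choose 2)" (is ?square)
    and "(s + 1) * (s + 2 choose 2) = (s + 3 choose 3) + 2 * (s + 2 choose 3)" (is ?upper)
    and "(s + 1) * (s + 1 choose 2) = 2 * (s + 2 choose 3) + (s + 1 choose 3)" (is ?lower)
    and "(s + 1) ^ 3 = (s + 3 choose 3) + 4 * (s + 2 choose 3) + (s + 1 choose 3)"
proof -
  have squares: "(t + 1)\<^sup>2 = (t + 2 choose 2) + (t + 1 choose 2)" for t :: nat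
    by (induction t) (simp_all add: eval_nat_numeral)
  note square = squares[of s]
  show upper: ?upper
  proof (induction s)
    case (Suc s)
    then show ?case using squares[of s] by (simp add: eval_nat_numeral algebra_simps)
  qed (simp add: eval_nat_numeral)
  show lower: ?lower
  proof (induction s)
    case (Suc s)
    then show ?case using squares[of s] by (simp add: eval_nat_numeral algebra_simps)
  qed (simp add: eval_nat_numeral)
  show ?square by (rule square)
  have "(s + 1) ^ 3 = (s + 1) * (s + 1)\<^sup>2" by (simp add: power3_eq_cube power2_eq_square)
  also have "\<dots> = (s + 1) * (s + 2 choose 2) + (s + 1) * (s + 1 choose 2)"
    unfolding square by (rule distrib_left)
  finally show "(s + 1) ^ 3 = (s + 3 choose 3) + 4 * (s + 2 choose 3) + (s + 1 choose 3)"
    unfolding upper lower by simp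
qed

section \<open>Polytopes counted by slices\<close>

lemma card_eqI:
  assumes "\<And>p. p \<in> A \<Longrightarrow> f p \<in> B \<and> g (f p) = p"
    and "\<And>q. q \<in> B \<Longrightarrow> g q \<in> A \<and> f (g q) = q"
  shows "card A = card B"
  by (rule bij_betw_same_card[of f], rule bij_betw_byWitness[of _ g]) (use assms in blast)+

lemma card_triangle: "card {(x, y). x + y \<le> n} = (n + 2 choose 2)"
proof -
  have "card {(x, y). x + y \<le> n} = card (SIGMA s:{..n}. {..s})"
    by (rule card_eqI[where f = "\<lambda>(x, y). (x + y, x)" and g = "\<lambda>(s, x). (x, s - x)"]) auto
  also have "\<dots> = (\<Sum>s\<le>n. s + 1 choose 1)" by simp
  also have "\<dots> = (n + 2 choose 2)" by (subst sum_choose_pyramid) (simp_all add: eval_nat_numeral)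
  finally show ?thesis .
qed

lemma finite_triangle: "finite {(x, y). x + y \<le> (n::nat)}"
  by (rule finite_subset[of _ "{..n} \<times> {..n}"]) auto

lemma card_pts3_Ia: "card (pts3_Ia n) = (n + 3 choose 3)"
proof -
  have "card (pts3_Ia n) = card (SIGMA s:{..n}. {(x, y). x + y \<le> s})"
    by (rule card_eqI[where f = "\<lambda>(x, y, z). (x + y + z, x, y)"
          and g = "\<lambda>(s, x, y). (x, y, s - (x + y))"]) (auto simp: pts3_Ia_def)
  also have "\<dots> = (\<Sum>s\<le>n. s + 2 choose 2)"
    by (simp add: finite_triangle card_triangle)
  also have "\<dots> = (n + 3 choose 3)"
    by (subst sum_choose_pyramid) (simp_all add: eval_nat_numeral)
  finally show ?thesis .
qed

lemma card_pts4_IIc: "card (pts4_IIc n) = (n + 4 choose 4)"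
proof -
  have "card (pts4_IIc n) = card (SIGMA s:{..n}. pts3_Ia s)"
    by (rule card_eqI[where f = "\<lambda>(x, y, z, w). (x + y + z + w, x, y, z)"
          and g = "\<lambda>(s, x, y, z). (x, y, z, s - (x + y + z))"]) (auto simp: pts_defs)
  also have "\<dots> = (\<Sum>s\<le>n. s + 3 choose 3)"
    by (simp add: finite_pts3 card_pts3_Ia)
  also have "\<dots> = (n + 4 choose 4)"
    by (subst sum_choose_pyramid) (simp_all add: eval_nat_numeral)
  finally show ?thesis .
qed

text \<open>A pyramid over a square with apex at $y = 1$.\<close>

lemma card_pts3_IIc: "card (pts3_IIc n) = (n + 3 choose 3) + (n + 2 choose 3)"
proof -
  have "card (pts3_IIc n) = card (SIGMA s:{..n}. {..s} \<times> {..s})"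
    by (rule card_eqI[where f = "\<lambda>(x, y, z). (n - y, x, z)"
          and g = "\<lambda>(s, x, z). (x, n - s, z)"]) (auto simp: pts3_IIc_def)
  also have "\<dots> = (\<Sum>s\<le>n. (s + 1)\<^sup>2)" by (simp add: power2_eq_square)
  also have "\<dots> = (n + 3 choose 3) + (n + 2 choose 3)"
    unfolding choose_mult_identities sum.distrib
    by (subst (1 2) sum_choose_pyramid) (simp_all add: eval_nat_numeral)
  finally show ?thesis .
qed

text \<open>All constraints except $x + y + w \<le> n$ are homogeneous, so this is a pyramid with the origin
  as apex. Its slice $x + y + w = s$ is the $s$-th dilate of \<open>nabla3_IIc\<close> in the lattice
  coordinates $(x, w, x + y - z)$.\<close>

lemma card_pts4_Id: "card (pts4_Id n) = (n + 4 choose 4) + (n + 3 choose 4)"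
proof -
  have "card (pts4_Id n) = card (SIGMA s:{..n}. pts3_IIc s)"
    by (rule card_eqI[where f = "\<lambda>(x, y, z, w). (x + y + w, x, w, x + y - z)"
          and g = "\<lambda>(s, x, w, z). (x, s - x - w, s - w - z, w)"]) (auto simp: pts_defs)
  also have "\<dots> = (\<Sum>s\<le>n. (s + 3 choose 3) + (s + 2 choose 3))"
    by (simp add: finite_pts3 card_pts3_IIc)
  also have "\<dots> = (n + 4 choose 4) + (n + 3 choose 4)"
    unfolding sum.distrib
    by (subst (1 2) sum_choose_pyramid) (simp_all add: eval_nat_numeral)
  finally show ?thesis .
qed

lemma card_pts4_IIf: "card (pts4_IIf n) = (n + 4 choose 4) + 2 * (n + 3 choose 4)"
proof -
  have "card (pts4_IIf n) = card (SIGMA s:{..n}. {..s} \<times> {(x, y). x + y \<le> s})"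
    by (rule card_eqI[where f = "\<lambda>(x, y, z, w). (x + y + z, w, x, y)"
          and g = "\<lambda>(s, w, x, y). (x, y, s - (x + y), w)"]) (auto simp: pts_defs)
  also have "\<dots> = (\<Sum>s\<le>n. (s + 1) * (s + 2 choose 2))"
    by (simp add: finite_triangle card_triangle card_cartesian_product)
  also have "\<dots> = (n + 4 choose 4) + 2 * (n + 3 choose 4)"
    unfolding choose_mult_identities sum.distrib sum_distrib_left[symmetric]
    by (subst (1 2) sum_choose_pyramid) (simp_all add: eval_nat_numeral)
  finally show ?thesis .
qed

lemma card_pts4_Ia: "card (pts4_Ia n) = (n + 4 choose 4) + 4 * (n + 3 choose 4) + (n + 2 choose 4)"
proof -
  have "card (pts4_Ia n) = card (SIGMA s:{..n}. {..s} \<times> {..s} \<times> {..s})"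
    by (rule card_eqI[where f = "\<lambda>(x, y, z, w). (x + y, x, z, w)"
          and g = "\<lambda>(s, x, z, w). (x, s - x, z, w)"]) (auto simp: pts_defs)
  also have "\<dots> = (\<Sum>s\<le>n. (s + 1) ^ 3)"
    by (simp add: power3_eq_cube algebra_simps)
  also have "\<dots> = (n + 4 choose 4) + 4 * (n + 3 choose 4) + (n + 2 choose 4)"
    unfolding choose_mult_identities sum.distrib sum_distrib_left[symmetric]
    by (subst (1 2 3) sum_choose_pyramid) (simp_all add: eval_nat_numeral)
  finally show ?thesis .
qed

section \<open>Polytopes counted by cutting into pieces\<close>

lemma card_cut:
  assumes "finite S"
  shows "card S = card {p \<in> S. Q p} + card {p \<in> S. \<not> Q p}"
proof -
  have "S = {p \<in> S. Q p} \<union> {p \<in> S. \<not> Q p}" by blast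
  then show ?thesis
    using assms card_Un_disjoint[of "{p \<in> S. Q p}" "{p \<in> S. \<not> Q p}"] by auto
qed

text \<open>Cut along $x + y + w = n$. The part below is \<open>nabla4_Id\<close>. Above it, for $x + y = s$, the excess
  $v = x + y + w - n - 1$ ranges over $v < z \<le> s$, which is a triangle with one edge removed.\<close>

lemma card_pts4_IIId:
  "card (pts4_IIId n) = (n + 4 choose 4) + 3 * (n + 3 choose 4) + (n + 2 choose 4)"
proof -
  have "{p \<in> pts4_IIId n. case p of (x, y, z, w) \<Rightarrow> x + y + w \<le> n} = pts4_Id n"
    by (auto simp: pts_defs)
  moreover have "card {p \<in> pts4_IIId n. \<not> (case p of (x, y, z, w) \<Rightarrow> x + y + w \<le> n)} =
      card (SIGMA s:{..n}. {..s} \<times> (SIGMA z:{..s}. {..<z}))"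
    by (rule card_eqI[where f = "\<lambda>(x, y, z, w). (x + y, x, z, x + y + w - Suc n)"
          and g = "\<lambda>(s, x, z, v). (x, s - x, z, Suc n + v - s)"]) (auto simp: pts_defs)
  moreover have "\<dots> = (\<Sum>s\<le>n. (s + 1) * (\<Sum>z\<le>s. z + 0 choose 1))"
    by (simp add: card_cartesian_product)
  moreover have "\<dots> = (\<Sum>s\<le>n. (s + 1) * (s + 1 choose 2))"
    by (subst sum_choose_pyramid) (simp_all add: eval_nat_numeral)
  moreover have "\<dots> = 2 * (n + 3 choose 4) + (n + 2 choose 4)"
    unfolding choose_mult_identities sum.distrib sum_distrib_left[symmetric]
    by (subst (1 2) sum_choose_pyramid) (simp_all add: eval_nat_numeral)
  ultimately show ?thesis
    using card_cut[OF finite_pts4(4), of n "\<lambda>(x, y, z, w). x + y + w \<le> n"]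
    by (simp add: card_pts4_Id)
qed

text \<open>The cut is $x + y = n$. The reflection in the centre of the cube exchanges the two halves. The
  strict inequality $x + y > n$ that remains for the upper one accounts for the drop from
  \<open>Suc n\<close> to \<open>n\<close>.\<close>

lemma card_pts3_Ib_Suc: "card (pts3_Ib (Suc n)) = card (pts3_IIc (Suc n)) + card (pts3_IIc n)"
proof -
  have "card {p \<in> pts3_Ib (Suc n). case p of (x, y, z) \<Rightarrow> x + y \<le> Suc n} =
      card (pts3_IIc (Suc n))"
    by (rule card_eqI[where f = "\<lambda>(x, y, z). (x, Suc n - (x + y), z)"
          and g = "\<lambda>(x, y, z). (x, Suc n - (x + y), z)"]) (auto simp: pts_defs)
  moreover have "card {p \<in> pts3_Ib (Suc n). \<not> (case p of (x, y, z) \<Rightarrow> x + y \<le> Suc n)} =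
      card (pts3_IIc n)"
    by (rule card_eqI[where f = "\<lambda>(x, y, z). (Suc n - x, x + y - Suc (Suc n), Suc n - z)"
          and g = "\<lambda>(x, y, z). (Suc n - x, Suc x + y, Suc n - z)"]) (auto simp: pts_defs)
  ultimately show ?thesis
    using card_cut[OF finite_pts3(3), of "Suc n" "\<lambda>(x, y, z). x + y \<le> Suc n"] by simp
qed

text \<open>Cutting along $x + y = z + w$ decides which of the two sums is the smaller one; the smaller
  one then bounds both $x$ and $w$, and the larger one is a slack away from it. The two halves are
  exchanged by swapping $x$ with $w$ and $y$ with $z$.\<close>

lemma card_pts4_VIc_Suc: "card (pts4_VIc (Suc n)) = card (pts4_Id (Suc n)) + card (pts4_Id n)"
proof -
  have "card {p \<in> pts4_VIc (Suc n). case p of (x, y, z, w) \<Rightarrow> x + y \<le> z + w} =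
      card (pts4_Id (Suc n))"
    by (rule card_eqI[where f = "\<lambda>(x, y, z, w). (x, y, w, z + w - (x + y))"
          and g = "\<lambda>(x, y, w, d). (x, y, x + y + d - w, w)"]) (auto simp: pts_defs)
  moreover have "card {p \<in> pts4_VIc (Suc n). \<not> (case p of (x, y, z, w) \<Rightarrow> x + y \<le> z + w)} =
      card (pts4_Id n)"
    by (rule card_eqI[where f = "\<lambda>(x, y, z, w). (z, w, x, x + y - Suc (z + w))"
          and g = "\<lambda>(z, w, x, d). (x, Suc (z + w + d) - x, z, w)"]) (auto simp: pts_defs)
  ultimately show ?thesis
    using card_cut[OF finite_pts4(7), of "Suc n" "\<lambda>(x, y, z, w). x + y \<le> z + w"] by simp
qed

text \<open>Below the cut $x + y = n$ the slice with $x + y = s$ is a segment for $x$ times the triangle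
  $z + w \<le> s$, which is a slice of \<open>nabla4_IIf\<close>. Above the cut, with $x + y = 2n - s$, the
  triangle is $z \<ge> n - s$, $z + w \<le> n$, again of size $s$.\<close>

lemma card_pts4_VIIb_Suc: "card (pts4_VIIb (Suc n)) = card (pts4_IIf (Suc n)) + card (pts4_IIf n)"
proof -
  have "card {p \<in> pts4_VIIb (Suc n). case p of (x, y, z, w) \<Rightarrow> x + y \<le> Suc n} =
      card (pts4_IIf (Suc n))"
    by (rule card_eqI[where f = "\<lambda>(x, y, z, w). (z, w, x + y - (z + w), x)"
          and g = "\<lambda>(z, w, r, x). (x, z + w + r - x, z, w)"]) (auto simp: pts_defs)
  moreover have "card {p \<in> pts4_VIIb (Suc n). \<not> (case p of (x, y, z, w) \<Rightarrow> x + y \<le> Suc n)} =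
      card (pts4_IIf n)"
    by (rule card_eqI[where f = "\<lambda>(x, y, z, w). (w, Suc n - (z + w), Suc n + z - (x + y), Suc n - x)"
          and g = "\<lambda>(w, q, r, x). (Suc n - x, Suc n + x - (w + q + r), Suc n - (w + q), w)"])
      (auto simp: pts_defs)
  ultimately show ?thesis
    using card_cut[OF finite_pts4(8), of "Suc n" "\<lambda>(x, y, z, w). x + y \<le> Suc n"] by (simp only:)
qed

text \<open>For $z + w = s \<le> n$ the coordinates $x$, $y$ and $z$ range over \<open>{..s}\<close>. This is the slice
  of \<open>nabla4_Ia\<close>, and the reflection in the centre of the cube handles $z + w > n$.\<close>

lemma card_pts4_VIIIa_Suc: "card (pts4_VIIIa (Suc n)) = card (pts4_Ia (Suc n)) + card (pts4_Ia n)"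
proof -
  have "card {p \<in> pts4_VIIIa (Suc n). case p of (x, y, z, w) \<Rightarrow> z + w \<le> Suc n} =
      card (pts4_Ia (Suc n))"
    by (rule card_eqI[where f = "\<lambda>(x, y, z, w). (z, w, x, y)"
          and g = "\<lambda>(z, w, x, y). (x, y, z, w)"]) (auto simp: pts_defs)
  moreover have "card {p \<in> pts4_VIIIa (Suc n). \<not> (case p of (x, y, z, w) \<Rightarrow> z + w \<le> Suc n)} =
      card (pts4_Ia n)"
    by (rule card_eqI[where f = "\<lambda>(x, y, z, w). (Suc n - z, Suc n - w, Suc n - x, Suc n - y)"
          and g = "\<lambda>(z, w, x, y). (Suc n - x, Suc n - y, Suc n - z, Suc n - w)"])
      (auto simp: pts_defs)
  ultimately show ?thesis
    using card_cut[OF finite_pts4(9), of "Suc n" "\<lambda>(x, y, z, w). z + w \<le> Suc n"] by simp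
qed

text \<open>Below the cut $y + z = n$ the constraints are those of \<open>nabla4_IIId\<close> with renamed
  coordinates. Above it, with $y + z = 2n - s$, they say that $n - x$ and $w$ have sum at most $s$, which
  gives segment times triangle, a slice of \<open>nabla4_IIf\<close>.\<close>

lemma card_pts4_Xa_Suc: "card (pts4_Xa (Suc n)) = card (pts4_IIId (Suc n)) + card (pts4_IIf n)"
proof -
  have "card {p \<in> pts4_Xa (Suc n). case p of (x, y, z, w) \<Rightarrow> y + z \<le> Suc n} =
      card (pts4_IIId (Suc n))"
    by (rule card_eqI[where f = "\<lambda>(x, y, z, w). (y, z, x, w)"
          and g = "\<lambda>(y, z, x, w). (x, y, z, w)"]) (auto simp: pts_defs)
  moreover have "card {p \<in> pts4_Xa (Suc n). \<not> (case p of (x, y, z, w) \<Rightarrow> y + z \<le> Suc n)} =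
      card (pts4_IIf n)"
    by (rule card_eqI[where f = "\<lambda>(x, y, z, w). (Suc n - x, w, Suc n + x - (y + z + w), Suc n - y)"
          and g = "\<lambda>(a, w, r, b). (Suc n - a, Suc n - b, Suc n + b - (a + w + r), w)"])
      (auto simp: pts_defs)
  ultimately show ?thesis
    using card_cut[OF finite_pts4(11), of "Suc n" "\<lambda>(x, y, z, w). y + z \<le> Suc n"] by simp
qed

text \<open>The two cuts are $z + w = n$ and $x + y = n$. Since $x + y \<le> z + w$, the outer parts
  $z + w < n$ and $x + y > n$ are disjoint; they are exchanged by a reflection and are both pyramids
  without their base. The middle part has the closed constraints $x + y \<le> n \<le> z + w$.\<close>

lemma card_pts4_IXa_Suc:
  "card (pts4_IXa (Suc n)) = card (pts4_IIf n) + card (pts4_IIId (Suc n)) + card (pts4_IIf n)"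
proof -
  let ?S = "pts4_IXa (Suc n)"
  let ?low = "\<lambda>(x, y, z, w). z + w \<le> n" and ?high = "\<lambda>(x, y, z, w). Suc n < x + y"
  let ?R = "{p \<in> ?S. \<not> ?low p}"
  have "card {p \<in> ?S. ?low p} = card (pts4_IIf n)"
    by (rule card_eqI[where f = "\<lambda>(x, y, z, w). (x, y, z + w - (x + y), z)"
          and g = "\<lambda>(x, y, r, z). (x, y, z, x + y + r - z)"]) (auto simp: pts_defs)
  moreover have "card {p \<in> ?R. ?high p} = card (pts4_IIf n)"
    by (rule card_eqI[where
          f = "\<lambda>(x, y, z, w). (Suc n - z, Suc n - w, z + w - (x + y), Suc n - x)"
          and g = "\<lambda>(z, w, r, x). (Suc n - x, Suc n + x - (z + w + r), Suc n - z, Suc n - w)"])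
      (auto simp: pts_defs)
  moreover have "card {p \<in> ?R. \<not> ?high p} = card (pts4_IIId (Suc n))"
    by (rule card_eqI[where f = "\<lambda>(x, y, z, w). (x, y, Suc n + x + y - (z + w), Suc n - z)"
          and g = "\<lambda>(x, y, q, c). (x, y, Suc n - c, x + y + c - q)"]) (auto simp: pts_defs)
  ultimately show ?thesis
    using card_cut[OF finite_pts4(10), of "Suc n" ?low] card_cut[of ?R ?high] finite_pts4(10)[of "Suc n"]
    by simp
qed

text \<open>Each removed facet of a unimodular simplex raises the lower bound of one barycentric coordinate
  from 0 to 1; here \<open>k\<close> is the number of removed facets.\<close>

lemma card_simplex4: "card {(x, y, z, w). x + y + z + w + k \<le> n} = (n + 4 - k choose 4)"
proof (cases "k \<le> n")
  case True
  then have "{(x, y, z, w). x + y + z + w + k \<le> n} = pts4_IIc (n - k)"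
    by (auto simp: pts_defs)
  with True show ?thesis by (simp add: card_pts4_IIc)
next
  case False
  then have "{(x, y, z, w). x + y + z + w + k \<le> n} = {}" by auto
  with False show ?thesis by (simp only: card.empty) (simp add: binomial_eq_0)
qed

text \<open>The vertices of \<open>nabla4_Vb\<close> are $A = (0,1,1,0)$, $B = (1,0,0,1)$, $O = (0,0,0,0)$ and
  $P = (1,0,1,0)$, $Q = (0,1,0,0)$, $R = (0,0,0,1)$, with $A + B + O = (1,1,1,1) = P + Q + R$. A point of
  the $n$-th dilate is a sum $aA + bB + oO + pP + qQ + rR$ with $a + b + o + p + q + r = n$, and the
  relation makes this unique once $\min(a, b, o) = 0$. In terms of the point,
  $$b = x - p, \quad a = z - p, \quad q = y - z + p, \quad r = w - x + p, \quad o = n - y - w - p,$$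
  so $p = \min(x, z, n - y - w)$. The cells are $o = 0$, then $o > 0$ with $b = 0$, and finally
  $o, b > 0$ with $a = 0$.\<close>

lemma card_pts4_Vb:
  "card (pts4_Vb n) = (n + 4 choose 4) + (n + 3 choose 4) + (n + 2 choose 4)"
proof -
  let ?S = "pts4_Vb n"
  let ?o = "\<lambda>(x, y, z, w). n \<le> x + y + w \<and> n \<le> z + y + w" and ?b = "\<lambda>(x, y, z, w). x \<le> z"
  let ?R = "{p \<in> ?S. \<not> ?o p}"
  have "card {p \<in> ?S. ?o p} = card {(a, b, q, r). a + b + q + r + 0 \<le> n}"
    by (rule card_eqI[where f = "\<lambda>(x, y, z, w).
            (y + z + w - n, x + y + w - n, n - (z + w), n - (x + y))"
          and g = "\<lambda>(a, b, q, r). (n - (a + q + r), a + q, n - (b + q + r), b + r)"])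
      (auto simp: pts_defs)
  moreover have "card {p \<in> ?R. ?b p} = card {(a, p, q, r). a + p + q + r + 1 \<le> n}"
    by (rule card_eqI[where f = "\<lambda>(x, y, z, w). (z - x, x, x + y - z, w)"
          and g = "\<lambda>(a, p, q, r). (p, a + q, a + p, r)"]) (auto simp: pts_defs)
  \<comment> \<open>Here the bound variable $b$ stands for the coefficient of $B$ minus one.\<close>
  moreover have "card {p \<in> ?R. \<not> ?b p} = card {(b, p, q, r). b + p + q + r + 2 \<le> n}"
    by (rule card_eqI[where f = "\<lambda>(x, y, z, w). (x - Suc z, z, y, z + w - x)"
          and g = "\<lambda>(b, p, q, r). (Suc b + p, q, p, Suc b + r)"]) (auto simp: pts_defs)
  ultimately show ?thesis
    using card_cut[OF finite_pts4(6), of n ?o] card_cut[of ?R ?b] finite_pts4(6)[of n]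
    unfolding card_simplex4 by (simp add: numeral_eq_Suc)
qed

text \<open>Passing from $n$ to $n - 1$ shifts the $h^*$-vector by one place.\<close>

lemma card_pts_cut:
  assumes "0 < n"
  shows "card (pts3_Ib n) = (n + 3 choose 3) + 2 * (n + 2 choose 3) + (n + 1 choose 3)"
    and "card (pts4_VIc n) = (n + 4 choose 4) + 2 * (n + 3 choose 4) + (n + 2 choose 4)"
    and "card (pts4_VIIb n) = (n + 4 choose 4) + 3 * (n + 3 choose 4) + 2 * (n + 2 choose 4)"
    and "card (pts4_VIIIa n) =
      (n + 4 choose 4) + 5 * (n + 3 choose 4) + 5 * (n + 2 choose 4) + (n + 1 choose 4)"
    and "card (pts4_IXa n) = (n + 4 choose 4) + 5 * (n + 3 choose 4) + 5 * (n + 2 choose 4)"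
    and "card (pts4_Xa n) = (n + 4 choose 4) + 4 * (n + 3 choose 4) + 3 * (n + 2 choose 4)"
proof -
  obtain m where n: "n = Suc m" using assms gr0_conv_Suc by blast
  have shift: "m + 4 choose k = Suc m + 3 choose k" "m + 3 choose k = Suc m + 2 choose k"
    "m + 2 choose k = Suc m + 1 choose k" for k
    by (simp_all add: eval_nat_numeral)
  note base = card_pts3_IIc card_pts4_Id card_pts4_IIf card_pts4_Ia card_pts4_IIId
  show "card (pts3_Ib n) = (n + 3 choose 3) + 2 * (n + 2 choose 3) + (n + 1 choose 3)"
    unfolding n card_pts3_Ib_Suc base shift by simp
  show "card (pts4_VIc n) = (n + 4 choose 4) + 2 * (n + 3 choose 4) + (n + 2 choose 4)"
    unfolding n card_pts4_VIc_Suc base shift by simp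
  show "card (pts4_VIIb n) = (n + 4 choose 4) + 3 * (n + 3 choose 4) + 2 * (n + 2 choose 4)"
    unfolding n card_pts4_VIIb_Suc base shift by simp
  show "card (pts4_VIIIa n) =
      (n + 4 choose 4) + 5 * (n + 3 choose 4) + 5 * (n + 2 choose 4) + (n + 1 choose 4)"
    unfolding n card_pts4_VIIIa_Suc base shift by simp
  show "card (pts4_IXa n) = (n + 4 choose 4) + 5 * (n + 3 choose 4) + 5 * (n + 2 choose 4)"
    unfolding n card_pts4_IXa_Suc base shift by simp
  show "card (pts4_Xa n) = (n + 4 choose 4) + 4 * (n + 3 choose 4) + 3 * (n + 2 choose 4)"
    unfolding n card_pts4_Xa_Suc base shift by simp
qed

section \<open>The Ehrhart polynomials\<close>

lemmas card_pts = card_pts3_Ia card_pts3_IIc card_pts4_IIc card_pts4_Id card_pts4_IIf card_pts4_Ia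
  card_pts4_IIId card_pts4_Vb card_pts_cut

lemma gchoose_add_numeral:
  fixes n :: rat
  shows "(n + 3) gchoose 3 = (n + 1) * (n + 2) * (n + 3) / 6"
    and "(n + 2) gchoose 3 = n * (n + 1) * (n + 2) / 6"
    and "(n + 1) gchoose 3 = (n - 1) * n * (n + 1) / 6"
    and "(n + 4) gchoose 4 = (n + 1) * (n + 2) * (n + 3) * (n + 4) / 24"
    and "(n + 3) gchoose 4 = n * (n + 1) * (n + 2) * (n + 3) / 24"
    and "(n + 2) gchoose 4 = (n - 1) * n * (n + 1) * (n + 2) / 24"
    and "(n + 1) gchoose 4 = (n - 2) * (n - 1) * n * (n + 1) / 24"
  by (simp_all add: gbinomial_prod_rev eval_nat_numeral field_simps)

lemma of_nat_choose_add:
  "rat_of_nat (n + numeral k choose m) = (of_nat n + numeral k) gchoose m"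
  "rat_of_nat (n + 1 choose m) = (of_nat n + 1) gchoose m"
  by (simp_all add: binomial_gbinomial add.commute)

lemmas by_counting3 =
  is_ehrhart_polynomial_3I[OF nabla3_Ia_def, where S = pts3_Ia]
  is_ehrhart_polynomial_3I[OF nabla3_IIc_def, where S = pts3_IIc]
  is_ehrhart_polynomial_3I[OF nabla3_Ib_def, where S = pts3_Ib]

lemma ehrhart_polynomials3:
  shows "is_ehrhart_polynomial nabla3_Ia (smult (1 / 6) [:6, 11, 6, 1:])"
    and "is_ehrhart_polynomial nabla3_IIc (smult (1 / 6) [:6, 13, 9, 2:])"
    and "is_ehrhart_polynomial nabla3_Ib (smult (1 / 6) [:6, 14, 12, 4:])"
  by (rule by_counting3, simp, force simp: pts_defs field_simps simp flip: of_nat_add,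
      rule finite_pts3,
      simp only: card_pts of_nat_add of_nat_mult of_nat_numeral of_nat_choose_add
        gchoose_add_numeral,
      simp add: field_simps)+

lemmas by_counting4 =
  is_ehrhart_polynomial_4I[OF nabla4_IIc_def, where S = pts4_IIc]
  is_ehrhart_polynomial_4I[OF nabla4_Id_def, where S = pts4_Id]
  is_ehrhart_polynomial_4I[OF nabla4_IIf_def, where S = pts4_IIf]
  is_ehrhart_polynomial_4I[OF nabla4_IIId_def, where S = pts4_IIId]
  is_ehrhart_polynomial_4I[OF nabla4_Ia_def, where S = pts4_Ia]
  is_ehrhart_polynomial_4I[OF nabla4_Vb_def, where S = pts4_Vb]
  is_ehrhart_polynomial_4I[OF nabla4_VIc_def, where S = pts4_VIc]
  is_ehrhart_polynomial_4I[OF nabla4_VIIb_def, where S = pts4_VIIb]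
  is_ehrhart_polynomial_4I[OF nabla4_VIIIa_def, where S = pts4_VIIIa]
  is_ehrhart_polynomial_4I[OF nabla4_IXa_def, where S = pts4_IXa]
  is_ehrhart_polynomial_4I[OF nabla4_Xa_def, where S = pts4_Xa]

lemma ehrhart_polynomials4:
  shows "is_ehrhart_polynomial nabla4_IIc (smult (1 / 24) [:24, 50, 35, 10, 1:])"
    and "is_ehrhart_polynomial nabla4_Id (smult (1 / 24) [:24, 56, 46, 16, 2:])"
    and "is_ehrhart_polynomial nabla4_IIf (smult (1 / 24) [:24, 62, 57, 22, 3:])"
    and "is_ehrhart_polynomial nabla4_IIId (smult (1 / 24) [:24, 66, 67, 30, 5:])"
    and "is_ehrhart_polynomial nabla4_Ia (smult (1 / 24) [:24, 72, 78, 36, 6:])"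
    and "is_ehrhart_polynomial nabla4_Vb (smult (1 / 24) [:24, 54, 45, 18, 3:])"
    and "is_ehrhart_polynomial nabla4_VIc (smult (1 / 24) [:24, 60, 56, 24, 4:])"
    and "is_ehrhart_polynomial nabla4_VIIb (smult (1 / 24) [:24, 64, 66, 32, 6:])"
    and "is_ehrhart_polynomial nabla4_VIIIa (smult (1 / 24) [:24, 72, 84, 48, 12:])"
    and "is_ehrhart_polynomial nabla4_IXa (smult (1 / 24) [:24, 70, 85, 50, 11:])"
    and "is_ehrhart_polynomial nabla4_Xa (smult (1 / 24) [:24, 68, 76, 40, 8:])"
  by (rule by_counting4, simp, force simp: pts_defs field_simps simp flip: of_nat_add,
      rule finite_pts4,
      simp only: card_pts of_nat_add of_nat_mult of_nat_numeral of_nat_choose_add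
        gchoose_add_numeral,
      simp add: field_simps)+

theorem proposition9p1:
  shows "
    (\<exists>L. is_ehrhart_polynomial nabla3_Ia L \<and> (\<forall>n::rat.
        poly L n = ((n + 3) gchoose 3) \<and>
        poly L n = 1/6 * (n ^ 3 + 6 * n ^ 2 + 11 * n + 6))) \<and>
    (\<exists>L. is_ehrhart_polynomial nabla3_IIc L \<and> (\<forall>n::rat.
        poly L n = ((n + 3) gchoose 3) + ((n + 2) gchoose 3) \<and>
        poly L n = 1/6 * (2 * n ^ 3 + 9 * n ^ 2 + 13 * n + 6))) \<and>
    (\<exists>L. is_ehrhart_polynomial nabla3_Ib L \<and> (\<forall>n::rat.
        poly L n = ((n + 3) gchoose 3) + 2 * ((n + 2) gchoose 3) + ((n + 1) gchoose 3) \<and>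
        poly L n = 1/6 * (4 * n ^ 3 + 12 * n ^ 2 + 14 * n + 6))) \<and>
    (\<exists>L. is_ehrhart_polynomial nabla4_IIc L \<and> (\<forall>n::rat.
        poly L n = ((n + 4) gchoose 4) \<and>
        poly L n = 1/24 * (n ^ 4 + 10 * n ^ 3 + 35 * n ^ 2 + 50 * n + 24))) \<and>
    (\<exists>L. is_ehrhart_polynomial nabla4_Id L \<and> (\<forall>n::rat.
        poly L n = ((n + 4) gchoose 4) + ((n + 3) gchoose 4) \<and>
        poly L n = 1/24 * (2 * n ^ 4 + 16 * n ^ 3 + 46 * n ^ 2 + 56 * n + 24))) \<and>
    (\<exists>L. is_ehrhart_polynomial nabla4_IIf L \<and> (\<forall>n::rat.
        poly L n = ((n + 4) gchoose 4) + 2 * ((n + 3) gchoose 4) \<and>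
        poly L n = 1/24 * (3 * n ^ 4 + 22 * n ^ 3 + 57 * n ^ 2 + 62 * n + 24))) \<and>
    (\<exists>L. is_ehrhart_polynomial nabla4_IIId L \<and> (\<forall>n::rat.
        poly L n = ((n + 4) gchoose 4) + 3 * ((n + 3) gchoose 4) + ((n + 2) gchoose 4) \<and>
        poly L n = 1/24 * (5 * n ^ 4 + 30 * n ^ 3 + 67 * n ^ 2 + 66 * n + 24))) \<and>
    (\<exists>L. is_ehrhart_polynomial nabla4_Ia L \<and> (\<forall>n::rat.
        poly L n = ((n + 4) gchoose 4) + 4 * ((n + 3) gchoose 4) + ((n + 2) gchoose 4) \<and>
        poly L n = 1/24 * (6 * n ^ 4 + 36 * n ^ 3 + 78 * n ^ 2 + 72 * n + 24))) \<and>
    (\<exists>L. is_ehrhart_polynomial nabla4_Vb L \<and> (\<forall>n::rat.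
        poly L n = ((n + 4) gchoose 4) + ((n + 3) gchoose 4) + ((n + 2) gchoose 4) \<and>
        poly L n = 1/24 * (3 * n ^ 4 + 18 * n ^ 3 + 45 * n ^ 2 + 54 * n + 24))) \<and>
    (\<exists>L. is_ehrhart_polynomial nabla4_VIc L \<and> (\<forall>n::rat.
        poly L n = ((n + 4) gchoose 4) + 2 * ((n + 3) gchoose 4) + ((n + 2) gchoose 4) \<and>
        poly L n = 1/24 * (4 * n ^ 4 + 24 * n ^ 3 + 56 * n ^ 2 + 60 * n + 24))) \<and>
    (\<exists>L. is_ehrhart_polynomial nabla4_VIIb L \<and> (\<forall>n::rat.
        poly L n = ((n + 4) gchoose 4) + 3 * ((n + 3) gchoose 4) + 2 * ((n + 2) gchoose 4) \<and>
        poly L n = 1/24 * (6 * n ^ 4 + 32 * n ^ 3 + 66 * n ^ 2 + 64 * n + 24))) \<and>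
    (\<exists>L. is_ehrhart_polynomial nabla4_VIIIa L \<and> (\<forall>n::rat.
        poly L n = ((n + 4) gchoose 4) + 5 * ((n + 3) gchoose 4) + 5 * ((n + 2) gchoose 4) + ((n + 1) gchoose 4) \<and>
        poly L n = 1/24 * (12 * n ^ 4 + 48 * n ^ 3 + 84 * n ^ 2 + 72 * n + 24))) \<and>
    (\<exists>L. is_ehrhart_polynomial nabla4_IXa L \<and> (\<forall>n::rat.
        poly L n = ((n + 4) gchoose 4) + 5 * ((n + 3) gchoose 4) + 5 * ((n + 2) gchoose 4) \<and>
        poly L n = 1/24 * (11 * n ^ 4 + 50 * n ^ 3 + 85 * n ^ 2 + 70 * n + 24))) \<and>
    (\<exists>L. is_ehrhart_polynomial nabla4_Xa L \<and> (\<forall>n::rat.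
        poly L n = ((n + 4) gchoose 4) + 4 * ((n + 3) gchoose 4) + 3 * ((n + 2) gchoose 4) \<and>
        poly L n = 1/24 * (8 * n ^ 4 + 40 * n ^ 3 + 76 * n ^ 2 + 68 * n + 24)))"
  by ((rule conjI exI allI ehrhart_polynomials3 ehrhart_polynomials4)+
    | simp add: gchoose_add_numeral field_simps power2_eq_square power3_eq_cube power4_eq_xxxx)+

end
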